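(* Let $\xi_1,\xi_2,\ldots$ be a swap-invariant sequence of (integrable, not almost surely zero) random variables. Then $n^{-1}(\xi_1+\cdots+\xi_n)$ converges almost surely to an integrable random variable $X$ as $n\to\infty$.
   Context: Two integrable random vectors $\xi,\xi^*$ in $\mathbb{R}^d$ are zonoid equivalent if $\mathbf{E}|\langle u,\xi\rangle|=\mathbf{E}|\langle u,\xi^*\rangle|$ for all $u\in\mathbb{R}^d$. An integrable random vector is called swap-invariant if all random vectors obtained by permutations of its coordinates are zonoid equivalent. A sequence of integrable random variables is called swap-invariant if all its finite subsequences are swap-invariant (as random vectors). *)

theory Defs
  imports "HOL-Probability.Probability" "HOL-Combinatorics.Permutations"
begin

text \<open>
  A random vector in \<open>\<real>\<^sup>d\<close> on \<open>M\<close> is given by its coordinates \<open>X 0, \<dots>, X (d - 1)\<close>;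
  values of \<open>X\<close> (and of \<open>u\<close> below) at indices \<open>\<ge> d\<close> are irrelevant.
\<close>

definition integrable_vector :: "'a measure \<Rightarrow> nat \<Rightarrow> (nat \<Rightarrow> 'a \<Rightarrow> real) \<Rightarrow> bool" where
  "integrable_vector M d X \<longleftrightarrow> (\<forall>i<d. integrable M (X i))"

definition zonoid_equivalent ::
  "nat \<Rightarrow> 'a measure \<Rightarrow> (nat \<Rightarrow> 'a \<Rightarrow> real) \<Rightarrow> 'b measure \<Rightarrow> (nat \<Rightarrow> 'b \<Rightarrow> real) \<Rightarrow> bool" where
  "zonoid_equivalent d M X N Y \<longleftrightarrow>
     integrable_vector M d X \<and> integrable_vector N d Y \<and>
     (\<forall>u :: nat \<Rightarrow> real.
        (\<integral>\<omega>. \<bar>\<Sum>i<d. u i * X i \<omega>\<bar> \<partial>M) = (\<integral>\<omega>. \<bar>\<Sum>i<d. u i * Y i \<omega>\<bar> \<partial>N))"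

definition swap_invariant_vector :: "'a measure \<Rightarrow> nat \<Rightarrow> (nat \<Rightarrow> 'a \<Rightarrow> real) \<Rightarrow> bool" where
  "swap_invariant_vector M d X \<longleftrightarrow>
     integrable_vector M d X \<and>
     (\<forall>\<sigma> \<tau>. \<sigma> permutes {..<d} \<longrightarrow> \<tau> permutes {..<d} \<longrightarrow>
        zonoid_equivalent d M (\<lambda>i. X (\<sigma> i)) M (\<lambda>i. X (\<tau> i)))"

definition swap_invariant_sequence :: "'a measure \<Rightarrow> (nat \<Rightarrow> 'a \<Rightarrow> real) \<Rightarrow> bool" where
  "swap_invariant_sequence M \<xi> \<longleftrightarrow>
     (\<forall>n. integrable M (\<xi> n)) \<and>
     (\<forall>d k. strict_mono_on {..<d} k \<longrightarrow> swap_invariant_vector M d (\<lambda>i. \<xi> (k i)))"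

end

theory Submission
  imports Defs
begin

text \<open>
  Fix \<open>k\<close> and let \<open>Q\<close> have density \<open>\<bar>\<xi> k\<bar>\<close> with respect to \<open>M\<close>. For a linear combination \<open>V\<close> of later terms,
  swap-invariance says that \<open>E \<bar>a \<xi> k + V\<bar>\<close> does not change, for any \<open>a\<close>, when the indices in \<open>V\<close> are
  shifted. The derivative in \<open>a\<close> of this function is, up to constants, the distribution function of
  \<open>V / \<xi> k\<close> under \<open>Q\<close>. Hence all linear combinations of the ratios \<open>\<xi> (k + 1 + i) / \<xi> k\<close> have shift-invariant
  laws, so the ratios form a stationary sequence under \<open>Q\<close>, and by Birkhoff's theorem their averages
  converge \<open>Q\<close>-almost everywhere, that is, almost everywhere on \<open>\<xi> k \<noteq> 0\<close>. Where all \<open>\<xi> k\<close> vanish there is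
  nothing to show, and the limit is integrable by Fatou's lemma.
\<close>

subsection \<open>Birkhoff's ergodic theorem\<close>

text \<open>The total mass is left arbitrary because the ergodic theorem is later applied to the law
  of a sequence under a measure with density \<open>\<bar>\<xi> k\<bar>\<close>, whose mass need not
  be 1.\<close>

locale measure_preserving = finite_measure M for M :: "'a measure" +
  fixes T :: "'a \<Rightarrow> 'a"
  assumes measurable_T [measurable]: "T \<in> measurable M M"
    and distr_T: "distr M M T = M"
begin

lemma integrable_comp_T:
  fixes f :: "'a \<Rightarrow> real"
  assumes "integrable M f"
  shows "integrable M (\<lambda>x. f (T x))"
  using integrable_distr[OF measurable_T, of f] assms by (simp add: distr_T)

lemma integral_comp_T:
  fixes f :: "'a \<Rightarrow> real"
  assumes "integrable M f"
  shows "(\<integral>x. f (T x) \<partial>M) = (\<integral>x. f x \<partial>M)"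
  using integral_distr[OF measurable_T, of f] assms by (simp add: distr_T)

lemma measurable_T_funpow [measurable]: "(T ^^ n) \<in> measurable M M"
  by (induction n) simp_all

section \<open>Orbit sums and the maximal ergodic inequality\<close>

definition orbit_sum :: "('a \<Rightarrow> real) \<Rightarrow> nat \<Rightarrow> 'a \<Rightarrow> real" where
  "orbit_sum f n x = (\<Sum>i<n. f ((T ^^ i) x))"

lemma orbit_sum_0: "orbit_sum f 0 x = 0"
  by (simp add: orbit_sum_def)

lemma orbit_sum_Suc: "orbit_sum f (Suc n) x = f x + orbit_sum f n (T x)"
  unfolding orbit_sum_def by (subst sum.lessThan_Suc_shift) (simp add: funpow_swap1)

lemma measurable_orbit_sum [measurable]:
  assumes [measurable]: "f \<in> borel_measurable M"
  shows "orbit_sum f n \<in> borel_measurable M"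
  unfolding orbit_sum_def
  by (intro borel_measurable_sum measurable_compose[OF measurable_T_funpow]) measurable

text \<open>The value at \<open>x\<close> is the maximum of the orbit sums of length at most \<open>n\<close>.\<close>

primrec orbit_max :: "('a \<Rightarrow> real) \<Rightarrow> nat \<Rightarrow> 'a \<Rightarrow> real" where
  "orbit_max f 0 x = 0"
| "orbit_max f (Suc n) x = max 0 (f x + orbit_max f n (T x))"

lemma orbit_max_mono: "orbit_max f n x \<le> orbit_max f (Suc n) x"
proof (induction n arbitrary: x)
  case (Suc n)
  from Suc[of "T x"] show ?case by auto
qed simp

lemma orbit_sum_le_orbit_max: "n \<le> m \<Longrightarrow> orbit_sum f n x \<le> orbit_max f m x"
proof (induction n arbitrary: m x)
  case 0
  then show ?case by (cases m) (simp_all add: orbit_sum_0)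
next
  case (Suc n)
  then obtain m' where m: "m = Suc m'" "n \<le> m'" by (cases m) auto
  from Suc.IH[OF m(2), of "T x"] show ?case by (auto simp: m orbit_sum_Suc)
qed

lemma integrable_orbit_max:
  assumes "integrable M f"
  shows "integrable M (orbit_max f n)"
proof (induction n)
  case 0
  have "orbit_max f 0 = (\<lambda>_. 0)" by (simp add: fun_eq_iff)
  then show ?case by (simp only: Bochner_Integration.integrable_zero)
next
  case (Suc n)
  have "orbit_max f (Suc n) = (\<lambda>x. max 0 (f x + orbit_max f n (T x)))"
    by (simp add: fun_eq_iff)
  moreover have "integrable M (\<lambda>x. max 0 (f x + orbit_max f n (T x)))"
    by (intro integrable_max Bochner_Integration.integrable_add Bochner_Integration.integrable_zero
        integrable_comp_T Suc assms)
  ultimately show ?case by (simp only:)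
qed

text \<open>Garsia's argument: on the set where \<open>orbit_max f (Suc n)\<close> is positive,
  \<open>f x\<close> dominates \<open>orbit_max f (Suc n) x - orbit_max f (Suc n) (T x)\<close>;
  elsewhere this difference is at most 0, and its integral vanishes by invariance of the measure. As
  \<open>n\<close> grows, these sets come to contain every point with \<open>f x \<noteq> 0\<close>.
  Tolerating zeros of \<open>f\<close> makes the lemma applicable to functions cut off to an
  invariant set.\<close>

lemma maximal_ergodic:
  assumes f: "integrable M f"
    and pos: "\<And>x. x \<in> space M \<Longrightarrow> f x \<noteq> 0 \<Longrightarrow> \<exists>n. 0 < orbit_sum f n x"
  shows "0 \<le> (\<integral>x. f x \<partial>M)"
proof -
  have [measurable]: "f \<in> borel_measurable M" using f by auto
  have [measurable]: "orbit_max f n \<in> borel_measurable M" for n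
    using integrable_orbit_max[OF f, of n] by auto
  define g where "g n x = indicator {x \<in> space M. 0 < orbit_max f (Suc n) x} x * f x" for n x
  have int_g: "0 \<le> (\<integral>x. g n x \<partial>M)" for n
  proof -
    have "(\<integral>x. orbit_max f (Suc n) x - orbit_max f (Suc n) (T x) \<partial>M) \<le> (\<integral>x. g n x \<partial>M)"
    proof (rule integral_mono)
      show "integrable M (\<lambda>x. orbit_max f (Suc n) x - orbit_max f (Suc n) (T x))"
        by (intro Bochner_Integration.integrable_diff integrable_comp_T integrable_orbit_max f)
      show "integrable M (g n)"
        unfolding g_def by (subst mult.commute) (intro integrable_real_mult_indicator f, measurable)
      fix x assume x: "x \<in> space M"
      \<comment> \<open>Where the maximum is positive, \<open>f x\<close> equals
        \<open>orbit_max f (Suc n) x - orbit_max f n (T x)\<close>, and monotonicity raises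
        \<open>n\<close> to \<open>Suc n\<close> in the subtracted term. Elsewhere the first term is
        0 and the subtracted one is nonnegative.\<close>
      have "orbit_max f n (T x) \<le> orbit_max f (Suc n) (T x)" by (rule orbit_max_mono)
      moreover have "0 \<le> orbit_max f (Suc n) (T x)" by simp
      ultimately show "orbit_max f (Suc n) x - orbit_max f (Suc n) (T x) \<le> g n x"
        using x by (cases "0 < f x + orbit_max f n (T x)") (auto simp: g_def)
    qed
    moreover have "(\<integral>x. orbit_max f (Suc n) x - orbit_max f (Suc n) (T x) \<partial>M) = 0"
      by (subst Bochner_Integration.integral_diff)
        (simp_all only: integrable_comp_T integrable_orbit_max f integral_comp_T diff_self)
    ultimately show ?thesis by simp
  qed
  have "(\<lambda>n. \<integral>x. g n x \<partial>M) \<longlonglongrightarrow> (\<integral>x. f x \<partial>M)"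
  proof (rule integral_dominated_convergence[where w="\<lambda>x. \<bar>f x\<bar>"])
    show "AE x in M. (\<lambda>n. g n x) \<longlonglongrightarrow> f x"
    proof (rule AE_I2)
      fix x assume x: "x \<in> space M"
      show "(\<lambda>n. g n x) \<longlonglongrightarrow> f x"
      proof (cases "f x = 0")
        case False
        from pos[OF x this] obtain n where n: "0 < orbit_sum f n x" ..
        have "g m x = f x" if "n \<le> m" for m
          using orbit_sum_le_orbit_max[of n "Suc m" f x] that n x by (auto simp: g_def indicator_def)
        then show ?thesis
          by (intro tendsto_eventually eventually_sequentiallyI[of n])
      qed (simp add: g_def)
    qed
    show "AE x in M. norm (g n x) \<le> \<bar>f x\<bar>" for n
      by (auto simp: g_def indicator_def)
    show "g n \<in> borel_measurable M" for n unfolding g_def by measurable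
  qed (use f in auto)
  then show ?thesis using int_g by (intro LIMSEQ_le_const) auto
qed

section \<open>Upper and lower ergodic means and their equality almost everywhere\<close>

definition upper_mean :: "('a \<Rightarrow> real) \<Rightarrow> 'a \<Rightarrow> ereal" where
  "upper_mean f x = limsup (\<lambda>n. ereal (orbit_sum f n x / real n))"

definition lower_mean :: "('a \<Rightarrow> real) \<Rightarrow> 'a \<Rightarrow> ereal" where
  "lower_mean f x = liminf (\<lambda>n. ereal (orbit_sum f n x / real n))"

lemma measurable_upper_mean [measurable]:
  assumes [measurable]: "f \<in> borel_measurable M"
  shows "upper_mean f \<in> borel_measurable M"
  unfolding upper_mean_def by measurable

lemma orbit_sum_uminus: "orbit_sum (\<lambda>x. - f x) n x = - orbit_sum f n x"
  by (simp add: orbit_sum_def sum_negf)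

lemma lower_mean_eq: "lower_mean f x = - upper_mean (\<lambda>x. - f x) x"
  unfolding lower_mean_def upper_mean_def orbit_sum_uminus
  by (subst ereal_Liminf_uminus[symmetric]) simp

lemma measurable_lower_mean [measurable]:
  assumes [measurable]: "f \<in> borel_measurable M"
  shows "lower_mean f \<in> borel_measurable M"
  unfolding lower_mean_def by measurable

text \<open>Splitting off the first term of an orbit sum costs a summand
  \<open>f x / (n + 1)\<close> that tends to 0 and a factor \<open>n / (n + 1)\<close> that tends to
  1. This invariance makes sets defined by the means admissible in the next estimate.\<close>

lemma upper_mean_comp_T: "upper_mean f (T x) = upper_mean f x"
proof -
  have "upper_mean f x = limsup (\<lambda>n. ereal (orbit_sum f (n + 1) x / real (n + 1)))"
    unfolding upper_mean_def by (rule limsup_shift[symmetric])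
  also have "\<dots> = limsup (\<lambda>n. ereal (f x / real (n + 1)) +
      ereal (real n / real (n + 1)) * ereal (orbit_sum f n (T x) / real n))"
    by (intro arg_cong[where f=limsup] ext)
      (auto simp: orbit_sum_Suc orbit_sum_0 add_divide_distrib)
  also have "\<dots> = 0 + limsup (\<lambda>n. ereal (real n / real (n + 1)) * ereal (orbit_sum f n (T x) / real n))"
  proof (rule ereal_limsup_lim_add)
    have "(\<lambda>n. f x / real (n + 1)) \<longlonglongrightarrow> 0"
      using LIMSEQ_ignore_initial_segment[OF lim_const_over_n, of "f x" 1] by simp
    then show "(\<lambda>n. ereal (f x / real (n + 1))) \<longlonglongrightarrow> 0" by (simp add: zero_ereal_def)
  qed simp
  also have "\<dots> = 0 + 1 * limsup (\<lambda>n. ereal (orbit_sum f n (T x) / real n))"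
  proof (subst ereal_limsup_lim_mult)
    have "(\<lambda>n. real n / real (n + 1)) \<longlonglongrightarrow> 1"
      using LIMSEQ_n_over_Suc_n by simp
    then show "(\<lambda>n. ereal (real n / real (n + 1))) \<longlonglongrightarrow> 1" by (simp add: one_ereal_def)
  qed simp_all
  finally show ?thesis by (simp add: upper_mean_def)
qed

lemma lower_mean_comp_T: "lower_mean f (T x) = lower_mean f x"
  by (simp add: lower_mean_eq upper_mean_comp_T)

text \<open>The maximal inequality is applied to \<open>f - b\<close> cut off to \<open>D\<close>.
  Since \<open>D\<close> is invariant, the orbit sums of the cut-off function at points of
  \<open>D\<close> are those of \<open>f - b\<close>, and an upper mean above \<open>b\<close>
  forces one of them to be positive.\<close>

lemma measure_le_of_upper_mean:
  assumes f: "integrable M f" and [measurable]: "D \<in> sets M"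
    and inv: "\<And>x. x \<in> space M \<Longrightarrow> T x \<in> D \<longleftrightarrow> x \<in> D"
    and less: "\<And>x. x \<in> D \<Longrightarrow> ereal b < upper_mean f x"
  shows "b * measure M D \<le> (\<integral>x. indicator D x * f x \<partial>M)"
proof -
  have [measurable]: "f \<in> borel_measurable M" using f by auto
  define g where "g x = indicator D x * (f x - b)" for x
  have Df: "integrable M (\<lambda>x. indicator D x * f x)"
    using integrable_real_mult_indicator[OF assms(2) f] by (simp add: mult.commute)
  have Db: "integrable M (\<lambda>x. indicator D x * b)"
    by (intro integrable_mult_left integrable_real_indicator) (auto simp: emeasure_eq_measure)
  have "x \<in> space M \<Longrightarrow> orbit_sum g n x = indicator D x * (orbit_sum f n x - real n * b)" for n x
  proof (induction n arbitrary: x)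
    case (Suc n)
    from Suc.prems have "T x \<in> space M" using measurable_space[OF measurable_T] by blast
    from Suc.IH[OF this] inv[OF Suc.prems] show ?case
      by (auto simp: orbit_sum_Suc g_def indicator_def algebra_simps)
  qed (simp add: orbit_sum_0)
  note sum_g = this
  have "0 \<le> (\<integral>x. g x \<partial>M)"
  proof (rule maximal_ergodic)
    show "integrable M g"
      unfolding g_def right_diff_distrib by (intro Bochner_Integration.integrable_diff Df Db)
    fix x assume x: "x \<in> space M" "g x \<noteq> 0"
    then have D: "x \<in> D" by (auto simp: g_def indicator_def split: if_splits)
    \<comment> \<open>The index must be positive: the average at 0 is 0 by the convention for
      division, so it could exceed a negative \<open>b\<close> without giving a positive orbit
      sum.\<close>
    obtain n where n: "0 < n" "ereal b < ereal (orbit_sum f n x / real n)"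
    proof (rule ccontr)
      assume *: "\<not> thesis"
      with that have "\<forall>n>0. ereal (orbit_sum f n x / real n) \<le> ereal b"
        by (meson not_le)
      then have "upper_mean f x \<le> ereal b"
        unfolding upper_mean_def
        by (intro Limsup_bounded eventually_mono[OF eventually_gt_at_top[of 0]]) auto
      with less[OF D] show False by simp
    qed
    then have "0 < orbit_sum g n x"
      using x D by (simp add: sum_g field_simps)
    then show "\<exists>n. 0 < orbit_sum g n x" ..
  qed
  also have "(\<integral>x. g x \<partial>M) = (\<integral>x. indicator D x * f x \<partial>M) - (\<integral>x. indicator D x * b \<partial>M)"
    unfolding g_def right_diff_distrib by (intro Bochner_Integration.integral_diff Df Db)
  also have "(\<integral>x. indicator D x * b \<partial>M) = b * measure M D" by simp
  finally show ?thesis by simp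
qed

text \<open>On the exceptional set the previous estimate holds for every real \<open>b\<close> with
  the same right-hand side, which forces measure 0.\<close>

lemma AE_upper_mean_less_infinity:
  assumes f: "integrable M f"
  shows "AE x in M. upper_mean f x \<noteq> \<infinity>"
proof -
  have [measurable]: "f \<in> borel_measurable M" using f by auto
  define D where "D = {x \<in> space M. upper_mean f x = \<infinity>}"
  have D [measurable]: "D \<in> sets M" unfolding D_def by measurable
  have le: "b * measure M D \<le> (\<integral>x. indicator D x * f x \<partial>M)" for b
    by (rule measure_le_of_upper_mean[OF f D])
      (use measurable_space[OF measurable_T] in \<open>auto simp: D_def upper_mean_comp_T\<close>)
  have "measure M D = 0"
  proof (rule ccontr)
    assume "measure M D \<noteq> 0"
    then show False
      \<comment> \<open>This \<open>b\<close> makes the left side equal to the right side plus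
        1.\<close>
      using le[of "((\<integral>x. indicator D x * f x \<partial>M) + 1) / measure M D"] by simp
  qed
  then have "AE x in M. x \<notin> D"
    by (intro AE_not_in) (auto simp: null_sets_def emeasure_eq_measure)
  with AE_space show ?thesis by eventually_elim (simp add: D_def)
qed

text \<open>The exceptional set \<open>D\<close> is invariant, so the estimate applies on it both to
  \<open>f\<close> with bound \<open>b\<close> and to \<open>- f\<close> with bound
  \<open>- a\<close>. Adding the two cancels the integrals and leaves
  \<open>(b - a) * measure M D \<le> 0\<close>.\<close>

lemma AE_lower_mean_ge_or_upper_mean_le:
  assumes f: "integrable M f" and ab: "a < b"
  shows "AE x in M. \<not> (lower_mean f x < ereal a \<and> ereal b < upper_mean f x)"
proof -
  have [measurable]: "f \<in> borel_measurable M" using f by auto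
  define D where "D = {x \<in> space M. lower_mean f x < ereal a \<and> ereal b < upper_mean f x}"
  have D [measurable]: "D \<in> sets M" unfolding D_def by measurable
  have inv: "T x \<in> D \<longleftrightarrow> x \<in> D" if "x \<in> space M" for x
    using that measurable_space[OF measurable_T that]
    by (simp add: D_def upper_mean_comp_T lower_mean_comp_T)
  have "b * measure M D \<le> (\<integral>x. indicator D x * f x \<partial>M)"
    by (rule measure_le_of_upper_mean[OF f D inv]) (auto simp: D_def)
  moreover have "- a * measure M D \<le> (\<integral>x. indicator D x * - f x \<partial>M)"
  proof (rule measure_le_of_upper_mean[OF _ D inv])
    fix x assume "x \<in> D"
    then show "ereal (- a) < upper_mean (\<lambda>x. - f x) x"
      by (simp add: D_def lower_mean_eq) (metis ereal_uminus_less_reorder uminus_ereal.simps(1))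
  qed (use f in auto)
  ultimately have "(b - a) * measure M D \<le> 0" by (simp add: algebra_simps)
  with ab have "measure M D = 0" by (simp add: mult_le_0_iff measure_le_0_iff)
  then have "AE x in M. x \<notin> D"
    by (intro AE_not_in) (auto simp: null_sets_def emeasure_eq_measure)
  with AE_space show ?thesis by eventually_elim (simp add: D_def)
qed

text \<open>Discarding countably many null sets, one for each rational pair \<open>a < b\<close>,
  leaves no gap between lower and upper mean. The bounds for \<open>f\<close> and \<open>- f\<close>
  then make the common value finite.\<close>

theorem birkhoff:
  assumes f: "integrable M f"
  shows "AE x in M. convergent (\<lambda>n. orbit_sum f n x / real n)"
proof -
  have "AE x in M. \<forall>a\<in>\<rat>. \<forall>b\<in>\<rat>. a < b \<longrightarrow> \<not> (lower_mean f x < ereal a \<and> ereal b < upper_mean f x)"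
    by (intro AE_ball_countable[THEN iffD2] ballI countable_rat)
      (use AE_lower_mean_ge_or_upper_mean_le[OF f] in auto)
  moreover have "AE x in M. upper_mean f x \<noteq> \<infinity>"
    by (rule AE_upper_mean_less_infinity[OF f])
  moreover have "AE x in M. upper_mean (\<lambda>x. - f x) x \<noteq> \<infinity>"
    by (rule AE_upper_mean_less_infinity) (use f in auto)
  ultimately show ?thesis
  proof eventually_elim
    case (elim x)
    have le: "lower_mean f x \<le> upper_mean f x"
      unfolding lower_mean_def upper_mean_def by (rule Liminf_le_Limsup) simp
    have "upper_mean f x \<le> lower_mean f x"
    proof (rule ccontr)
      assume "\<not> upper_mean f x \<le> lower_mean f x"
      then obtain c where c: "lower_mean f x < ereal c" "ereal c < upper_mean f x"
        using ereal_dense2[of "lower_mean f x" "upper_mean f x"] by (auto simp: not_le)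
      \<comment> \<open>Two reals inside the gap leave room for two rationals between them.\<close>
      from c(2) obtain d where d: "c < d" "ereal d < upper_mean f x"
        using ereal_dense2[of "ereal c" "upper_mean f x"] by auto
      from d(1) obtain a where a: "a \<in> \<rat>" "c < a" "a < d" using Rats_dense_in_real by blast
      from a(3) obtain b where b: "b \<in> \<rat>" "a < b" "b < d" using Rats_dense_in_real by blast
      have "lower_mean f x < ereal a" using c(1) a(2) by (meson less_ereal.simps(1) less_trans)
      moreover have "ereal b < upper_mean f x" using d(2) b(3) by (meson less_ereal.simps(1) less_trans)
      ultimately show False using elim(1) a(1) b(1,2) by blast
    qed
    with le have eq: "lower_mean f x = upper_mean f x" by simp
    \<comment> \<open>The bound for \<open>- f\<close> excludes the value minus infinity, as the
      lower mean of \<open>f\<close> is the negated upper mean of \<open>- f\<close>.\<close>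
    from elim(3) eq have "upper_mean f x \<noteq> - \<infinity>" by (auto simp: lower_mean_eq)
    with elim(2) obtain l where l: "upper_mean f x = ereal l" by (cases "upper_mean f x") auto
    have "(\<lambda>n. ereal (orbit_sum f n x / real n)) \<longlonglongrightarrow> ereal l"
      using eq l by (intro Liminf_eq_Limsup) (simp_all add: lower_mean_def upper_mean_def)
    then show ?case unfolding convergent_def by auto
  qed
qed

end

text \<open>The underlying space need not carry a map that shifts the sequence, so the argument
  moves to the space of real sequences with the law of \<open>X\<close>. Stationarity says exactly
  that the shift preserves this law, and the averages are ergodic averages of the coordinate at
  0.\<close>

lemma (in finite_measure) stationary_imp_convergent_mean:
  fixes X :: "nat \<Rightarrow> 'a \<Rightarrow> real"
  assumes X [measurable]: "\<And>i. X i \<in> borel_measurable M" and int: "integrable M (X 0)"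
    and stat: "distr M (Pi\<^sub>M UNIV (\<lambda>_. borel)) (\<lambda>x i. X i x) = distr M (Pi\<^sub>M UNIV (\<lambda>_. borel)) (\<lambda>x i. X (Suc i) x)"
  shows "AE x in M. convergent (\<lambda>n. (\<Sum>i<n. X i x) / real n)"
proof -
  let ?S = "Pi\<^sub>M UNIV (\<lambda>_. borel) :: (nat \<Rightarrow> real) measure"
  define P where "P = distr M ?S (\<lambda>x i. X i x)"
  define T :: "(nat \<Rightarrow> real) \<Rightarrow> nat \<Rightarrow> real" where "T = (\<lambda>s i. s (Suc i))"
  have mX: "(\<lambda>x i. X i x) \<in> measurable M ?S"
    by (intro measurable_PiM_single') auto
  have mT: "T \<in> measurable ?S ?S"
    unfolding T_def by (intro measurable_PiM_single') auto
  interpret P: finite_measure P unfolding P_def by (rule finite_measure_distr[OF mX])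
  interpret P: measure_preserving P T
  proof
    show "T \<in> measurable P P" using mT by (simp add: P_def)
    have "distr P P T = distr P ?S T" by (rule distr_cong) (simp_all add: P_def)
    also have "\<dots> = distr M ?S (\<lambda>x i. X (Suc i) x)"
      unfolding P_def by (subst distr_distr[OF mT mX]) (simp add: comp_def T_def)
    also have "\<dots> = P" by (simp add: stat P_def)
    finally show "distr P P T = P" .
  qed
  have "(T ^^ n) s i = s (i + n)" for n s i
    by (induction n arbitrary: i) (simp_all add: T_def)
  then have sum: "P.orbit_sum (\<lambda>s. s 0) n s = (\<Sum>i<n. s i)" for n s
    by (simp add: P.orbit_sum_def)
  have "integrable P (\<lambda>s. s 0)"
    unfolding P_def using int by (subst integrable_distr_eq[OF mX]) auto
  from P.birkhoff[OF this] have "AE s in P. convergent (\<lambda>n. (\<Sum>i<n. s i) / real n)"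
    by (simp add: sum)
  then show ?thesis unfolding P_def by (rule AE_distrD[OF mX])
qed

subsection \<open>Joint laws and linear combinations\<close>

lemma measure_distr_density:
  fixes w :: "'a \<Rightarrow> real"
  assumes w: "integrable M w" "\<And>x. 0 \<le> w x" and [measurable]: "Z \<in> measurable M N" "A \<in> sets N"
  shows "measure (distr (density M w) N Z) A = (\<integral>x. w x * indicator A (Z x) \<partial>M)"
proof -
  have [measurable]: "w \<in> borel_measurable M" using w by auto
  have "emeasure (distr (density M w) N Z) A = (\<integral>\<^sup>+x. ennreal (w x * indicator A (Z x)) \<partial>M)"
    by (auto simp: emeasure_distr emeasure_density indicator_def intro!: nn_integral_cong)
  also have "\<dots> = ennreal (\<integral>x. w x * indicator A (Z x) \<partial>M)"
    by (intro nn_integral_eq_integral Bochner_Integration.integrable_bound[OF w(1)])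
      (auto simp: indicator_def w)
  finally show ?thesis
    by (simp add: measure_def integral_nonneg_AE w)
qed

lemma finite_measure_density:
  fixes w :: "'a \<Rightarrow> real"
  assumes w: "integrable M w" "\<And>x. 0 \<le> w x"
  shows "finite_measure (density M w)"
proof
  have "emeasure (density M w) (space M) = (\<integral>\<^sup>+x. ennreal (w x) \<partial>M)"
    using w by (auto simp: emeasure_density intro!: nn_integral_cong)
  then show "emeasure (density M w) (space (density M w)) \<noteq> \<infinity>"
    using nn_integral_eq_integral[OF w(1)] w(2) by simp
qed

lemma char_distr_density:
  fixes w :: "'a \<Rightarrow> real"
  assumes w: "integrable M w" "\<And>x. 0 \<le> w x" and Z [measurable]: "Z \<in> borel_measurable M"
  shows "char (distr (density M w) borel Z) t =
    Complex (\<integral>x. w x * cos (t * Z x) \<partial>M) (\<integral>x. w x * sin (t * Z x) \<partial>M)"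
proof -
  have [measurable]: "w \<in> borel_measurable M" using w by auto
  have int: "integrable M (\<lambda>x. w x *\<^sub>R iexp (t * Z x))"
    by (intro Bochner_Integration.integrable_bound[OF w(1)]) auto
  have "char (distr (density M w) borel Z) t = (CLINT x|M. w x *\<^sub>R iexp (t * Z x))"
    unfolding char_def by (simp add: integral_distr integral_density w)
  also have "\<dots> = Complex (\<integral>x. Re (w x *\<^sub>R iexp (t * Z x)) \<partial>M) (\<integral>x. Im (w x *\<^sub>R iexp (t * Z x)) \<partial>M)"
    using integral_Re[OF int] integral_Im[OF int] by (simp add: complex_eq_iff)
  finally show ?thesis by (simp add: Re_exp Im_exp)
qed

lemma weighted_law_eqI:
  fixes u v :: "'a \<Rightarrow> real"
  assumes u: "integrable M u" "\<And>x. 0 \<le> u x" and v: "integrable M v" "\<And>x. 0 \<le> v x"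
    and [measurable]: "X \<in> borel_measurable M" "Y \<in> borel_measurable M" "A \<in> sets borel"
    and eq: "\<And>c s. (\<integral>x. u x * cos (c + s * X x) \<partial>M) = (\<integral>x. v x * cos (c + s * Y x) \<partial>M)"
  shows "(\<integral>x. u x * indicator A (X x) \<partial>M) = (\<integral>x. v x * indicator A (Y x) \<partial>M)"
proof -
  define m where "m = (\<integral>x. u x \<partial>M)"
  have mv: "m = (\<integral>x. v x \<partial>M)" using eq[of 0 0] by (simp add: m_def)
  have "m \<ge> 0" unfolding m_def using u by (simp add: integral_nonneg_AE)
  show ?thesis
  proof (cases "m = 0")
    case True
    \<comment> \<open>Zero total mass cannot be normalised to a probability, but then both
      nonnegative weights vanish almost everywhere.\<close>
    have "AE x in M. u x = 0" "AE x in M. v x = 0"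
      using True mv integral_nonneg_eq_0_iff_AE[OF u(1)] integral_nonneg_eq_0_iff_AE[OF v(1)] u v
      by (auto simp: m_def)
    then have "(\<integral>x. u x * indicator A (X x) \<partial>M) = 0" "(\<integral>x. v x * indicator A (Y x) \<partial>M) = 0"
      by (auto intro!: integral_eq_zero_AE)
    then show ?thesis by simp
  next
    case False
    with \<open>m \<ge> 0\<close> have m: "m > 0" by simp
    have int: "integrable M (\<lambda>x. u x / m)" "integrable M (\<lambda>x. v x / m)"
      "0 \<le> u x / m" "0 \<le> v x / m" for x
      using u v m by auto
    have dist: "real_distribution (distr (density M (\<lambda>x. w x / m)) borel Z)"
      if w: "integrable M w" "\<And>x. 0 \<le> w x" "(\<integral>x. w x \<partial>M) = m"
        and Z [measurable]: "Z \<in> borel_measurable M" for w Z :: "'a \<Rightarrow> real"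
    proof -
      have [measurable]: "w \<in> borel_measurable M" using w by auto
      have "(\<integral>\<^sup>+x. ennreal (w x / m) \<partial>M) = ennreal (\<integral>x. w x / m \<partial>M)"
        using w m by (intro nn_integral_eq_integral) auto
      also have "\<dots> = 1" using w m by simp
      finally have "prob_space (density M (\<lambda>x. w x / m))"
        by (intro prob_spaceI) (simp add: emeasure_density cong: nn_integral_cong)
      then show ?thesis by (rule prob_space.real_distribution_distr) simp
    qed
    \<comment> \<open>The phase \<open>- pi / 2\<close> turns the cosine into a sine, which supplies
      the imaginary part of the characteristic function; phase 0 supplies the real part.\<close>
    have eq_sin: "(\<integral>x. u x * sin (s * X x) \<partial>M) = (\<integral>x. v x * sin (s * Y x) \<partial>M)" for s
      using eq[of "- pi / 2" s] by (simp add: cos_diff)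
    have "distr (density M (\<lambda>x. u x / m)) borel X = distr (density M (\<lambda>x. v x / m)) borel Y"
    proof (rule Levy_uniqueness)
      show "char (distr (density M (\<lambda>x. u x / m)) borel X) = char (distr (density M (\<lambda>x. v x / m)) borel Y)"
        using eq[of 0] eq_sin by (intro ext) (simp add: char_distr_density int)
    qed (use dist u v in \<open>auto simp: mv[symmetric] m_def[symmetric]\<close>)
    then have "measure (distr (density M (\<lambda>x. u x / m)) borel X) A
             = measure (distr (density M (\<lambda>x. v x / m)) borel Y) A" by simp
    then show ?thesis using m by (simp add: measure_distr_density int)
  qed
qed

text \<open>Cosines with an arbitrary phase stand for characteristic functions, and coordinates are
  traded for indicators one at a time: the weight \<open>p (1 + W)\<close> in the induction step is
  nonnegative, so the one-dimensional uniqueness theorem applies to it.\<close>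

lemma (in finite_measure) joint_law_eqI:
  fixes X Y :: "nat \<Rightarrow> 'a \<Rightarrow> real"
  assumes X [measurable]: "\<And>i. X i \<in> borel_measurable M"
    and Y [measurable]: "\<And>i. Y i \<in> borel_measurable M"
    and A [measurable]: "\<And>i. A i \<in> sets borel"
    and eq: "\<And>c t. (\<integral>x. cos (c + (\<Sum>i<d. t i * X i x)) \<partial>M) = (\<integral>x. cos (c + (\<Sum>i<d. t i * Y i x)) \<partial>M)"
  shows "(\<integral>x. (\<Prod>i<d. indicator (A i) (X i x)) \<partial>M) = (\<integral>x. (\<Prod>i<d. indicator (A i) (Y i x)) \<partial>M :: real)"
proof -
  \<comment> \<open>\<open>p j\<close> carries the indicators of the first \<open>j\<close>
    coordinates and \<open>W j\<close> the cosine in the remaining ones. The induction on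
    \<open>j\<close> leads from the hypothesis at 0 to the claim at \<open>d\<close>.\<close>
  define p where "p j Z x = (\<Prod>i<j. indicator (A i) (Z i x) :: real)" for j and Z :: "nat \<Rightarrow> 'a \<Rightarrow> real" and x
  define W where "W j c t Z x = cos (c + (\<Sum>i=j..<d. t i * Z i x))"
    for j c t and Z :: "nat \<Rightarrow> 'a \<Rightarrow> real" and x
  have [measurable]: "p j Z \<in> borel_measurable M" "W j c t Z \<in> borel_measurable M"
    if [measurable]: "\<And>i. Z i \<in> borel_measurable M" for j c t Z
    unfolding p_def W_def by measurable
  have p01: "0 \<le> p j Z x" "p j Z x \<le> 1" for j Z x
    by (auto simp: p_def indicator_def intro!: prod_nonneg prod_le_1)
  have bnd: "integrable M f" if "f \<in> borel_measurable M" "\<And>x. \<bar>f x\<bar> \<le> 2" for f :: "'a \<Rightarrow> real"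
    using that by (intro integrable_const_bound[where B=2]) auto
  have W1: "\<bar>W j c t Z x\<bar> \<le> 1" for j c t Z x by (simp add: W_def)
  have ip: "integrable M (p j Z)" "integrable M (\<lambda>x. p j Z x * W j' c t Z x)"
    "integrable M (\<lambda>x. p j Z x * cos (a + b * Z j x))"
    "integrable M (\<lambda>x. p j Z x * indicator B (Z j x))"
    "integrable M (\<lambda>x. p j Z x * W j' c t Z x * indicator B (Z j x))"
    if [measurable]: "\<And>i. Z i \<in> borel_measurable M" "B \<in> sets borel" for j j' c t Z a b B
  proof -
    have "\<bar>p j Z x * W j' c t Z x\<bar> \<le> 1 * 1" for x unfolding abs_mult
      by (intro mult_mono) (use p01 W1 in auto)
    moreover have "\<bar>p j Z x * cos (a + b * Z j x)\<bar> \<le> 1 * 1" for x unfolding abs_mult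
      by (intro mult_mono) (use p01 in auto)
    ultimately have "\<bar>p j Z x * W j' c t Z x\<bar> \<le> 2" "\<bar>p j Z x * cos (a + b * Z j x)\<bar> \<le> 2"
      "\<bar>p j Z x\<bar> \<le> 2" for x
      by (smt (verit) p01)+
    moreover from this have "\<bar>p j Z x * indicator B (Z j x)\<bar> \<le> 2"
      "\<bar>p j Z x * W j' c t Z x * indicator B (Z j x)\<bar> \<le> 2" for x
      by (auto simp: indicator_def)
    ultimately show "integrable M (p j Z)" "integrable M (\<lambda>x. p j Z x * W j' c t Z x)"
      "integrable M (\<lambda>x. p j Z x * cos (a + b * Z j x))"
      "integrable M (\<lambda>x. p j Z x * indicator B (Z j x))"
      "integrable M (\<lambda>x. p j Z x * W j' c t Z x * indicator B (Z j x))"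
      by (auto intro!: bnd)
  qed
  have "\<forall>c t. (\<integral>x. p j X x * W j c t X x \<partial>M) = (\<integral>x. p j Y x * W j c t Y x \<partial>M)" if "j \<le> d" for j
    using that
  proof (induction j)
    case 0
    show ?case using eq by (simp add: p_def W_def atLeast0LessThan)
  next
    case (Suc j)
    then have j: "j < d" and IH: "\<And>c t. (\<integral>x. p j X x * W j c t X x \<partial>M) = (\<integral>x. p j Y x * W j c t Y x \<partial>M)"
      by auto
    have upd: "W j c (t(j := s)) Z x = cos (c + (\<Sum>i=Suc j..<d. t i * Z i x) + s * Z j x)" for c t s Z x
      using j by (simp add: W_def sum.atLeast_Suc_lessThan add_ac)
    have const: "W j c ((\<lambda>_. 0)(j := s)) Z x = cos (c + s * Z j x)" for c s Z x
      by (simp add: upd)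
    \<comment> \<open>The product-to-sum formula absorbs a cosine in coordinate \<open>j\<close>
      into two functions of the form \<open>W j\<close>, which the induction hypothesis
      covers.\<close>
    have prod_cos: "W (Suc j) c t Z x * cos (a + s * Z j x) =
      (W j (c + a) (t(j := s)) Z x + W j (c - a) (t(j := - s)) Z x) / 2" for c a t s Z x
      unfolding upd by (simp add: W_def cos_times_cos) (simp add: algebra_simps)
    have eq1: "(\<integral>x. p j X x * cos (a + s * X j x) \<partial>M) = (\<integral>x. p j Y x * cos (a + s * Y j x) \<partial>M)" for a s
      using IH[of a "(\<lambda>_. 0)(j := s)"] by (simp only: const)
    show ?case
    proof (intro allI)
      fix c t
      have split: "(\<integral>x. (p j Z x + p j Z x * W (Suc j) c t Z x) * cos (a + s * Z j x) \<partial>M) =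
          (\<integral>x. p j Z x * cos (a + s * Z j x) \<partial>M)
          + (\<integral>x. p j Z x * W j (c + a) (t(j := s)) Z x \<partial>M) / 2
          + (\<integral>x. p j Z x * W j (c - a) (t(j := - s)) Z x \<partial>M) / 2"
        if [measurable]: "\<And>i. Z i \<in> borel_measurable M" for a s Z
      proof -
        have "(\<lambda>x. (p j Z x + p j Z x * W (Suc j) c t Z x) * cos (a + s * Z j x)) =
          (\<lambda>x. p j Z x * cos (a + s * Z j x) + p j Z x * W j (c + a) (t(j := s)) Z x / 2
            + p j Z x * W j (c - a) (t(j := - s)) Z x / 2)"
          by (simp add: fun_eq_iff distrib_right mult.assoc prod_cos add_divide_distrib distrib_left)
        then show ?thesis using ip[where Z=Z and B="{}", OF that] by simp
      qed
      have "(\<integral>x. (p j X x + p j X x * W (Suc j) c t X x) * indicator (A j) (X j x) \<partial>M) =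
            (\<integral>x. (p j Y x + p j Y x * W (Suc j) c t Y x) * indicator (A j) (Y j x) \<partial>M)"
      proof (rule weighted_law_eqI)
        have nn: "0 \<le> p j Z x + p j Z x * W (Suc j) c t Z x" for Z x
        proof -
          have "0 \<le> p j Z x * (1 + W (Suc j) c t Z x)"
            by (intro mult_nonneg_nonneg p01) (use W1 in \<open>smt (verit)\<close>)
          then show ?thesis by (simp add: distrib_left)
        qed
        show "0 \<le> p j X x + p j X x * W (Suc j) c t X x" "0 \<le> p j Y x + p j Y x * W (Suc j) c t Y x" for x
          by (rule nn)+
        show "(\<integral>x. (p j X x + p j X x * W (Suc j) c t X x) * cos (a + s * X j x) \<partial>M) =
              (\<integral>x. (p j Y x + p j Y x * W (Suc j) c t Y x) * cos (a + s * Y j x) \<partial>M)" for a s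
          by (simp only: split X Y eq1 IH)
      qed (use ip[where Z=X and B="{}", OF X] ip[where Z=Y and B="{}", OF Y] in auto)
      \<comment> \<open>Subtracting the identity for the weight \<open>p j\<close> alone removes the
        1 that was added for positivity; the factor \<open>indicator (A j)\<close> turns
        \<open>p j\<close> into \<open>p (Suc j)\<close>.\<close>
      moreover have "(\<integral>x. p j X x * indicator (A j) (X j x) \<partial>M) = (\<integral>x. p j Y x * indicator (A j) (Y j x) \<partial>M)"
        by (rule weighted_law_eqI) (use ip[where Z=X and B="{}", OF X] ip[where Z=Y and B="{}", OF Y] p01 eq1 in auto)
      moreover have "(\<integral>x. (p j Z x + p j Z x * W (Suc j) c t Z x) * indicator (A j) (Z j x) \<partial>M) =
          (\<integral>x. p j Z x * indicator (A j) (Z j x) \<partial>M) + (\<integral>x. p (Suc j) Z x * W (Suc j) c t Z x \<partial>M)"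
        if [measurable]: "\<And>i. Z i \<in> borel_measurable M" for Z
      proof -
        have "(\<lambda>x. p (Suc j) Z x * W (Suc j) c t Z x)
            = (\<lambda>x. p j Z x * W (Suc j) c t Z x * indicator (A j) (Z j x))"
          by (simp add: p_def fun_eq_iff)
        then show ?thesis using ip[where Z=Z, OF that A, of j] by (simp only: distrib_right Bochner_Integration.integral_add)
      qed
      ultimately show "(\<integral>x. p (Suc j) X x * W (Suc j) c t X x \<partial>M) = (\<integral>x. p (Suc j) Y x * W (Suc j) c t Y x \<partial>M)"
        by (simp add: X Y)
    qed
  qed
  \<comment> \<open>At \<open>j = d\<close> no coordinate is left in the cosine, so phase 0 makes
    \<open>W\<close> equal to 1.\<close>
  from this[OF order_refl, rule_format, of 0 "\<lambda>_. 0"] show ?thesis by (simp add: p_def W_def)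
qed

text \<open>Finite measures on the product are determined by cylinders, and each cylinder constrains
  only finitely many coordinates, so the finite-dimensional statement suffices.\<close>

lemma (in finite_measure) distr_PiM_eqI:
  fixes X Y :: "nat \<Rightarrow> 'a \<Rightarrow> real"
  assumes X [measurable]: "\<And>i. X i \<in> borel_measurable M"
    and Y [measurable]: "\<And>i. Y i \<in> borel_measurable M"
    and eq: "\<And>d c t. (\<integral>x. cos (c + (\<Sum>i<d. t i * X i x)) \<partial>M) = (\<integral>x. cos (c + (\<Sum>i<d. t i * Y i x)) \<partial>M)"
  shows "distr M (Pi\<^sub>M UNIV (\<lambda>_. borel)) (\<lambda>x i. X i x) = distr M (Pi\<^sub>M UNIV (\<lambda>_. borel)) (\<lambda>x i. Y i x)"
proof (rule measure_eqI_PiM_infinite[where I=UNIV and M="\<lambda>_. borel"])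
  have meas [measurable]: "(\<lambda>x i. Z i x) \<in> measurable M (Pi\<^sub>M UNIV (\<lambda>_. borel))"
    if "\<And>i. Z i \<in> borel_measurable M" for Z :: "nat \<Rightarrow> 'a \<Rightarrow> real"
    using that by (intro measurable_PiM_single') auto
  show "finite_measure (distr M (Pi\<^sub>M UNIV (\<lambda>_. borel)) (\<lambda>x i. X i x))"
    by (intro finite_measure_distr meas X)
  fix A and J :: "nat set"
  assume J: "finite J" and A: "\<And>i. i \<in> J \<Longrightarrow> A i \<in> sets (borel :: real measure)"
  obtain d where d: "J \<subseteq> {..<d}" using J finite_nat_iff_bounded by blast
  \<comment> \<open>Padding with \<open>UNIV\<close> replaces the finite index set \<open>J\<close>
    by an initial segment without changing the cylinder.\<close>
  define B where "B i = (if i \<in> J then A i else UNIV)" for i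
  have [measurable]: "B i \<in> sets borel" for i using A by (simp add: B_def)
  have prod_ind: "(\<Prod>i<d. indicator (B i) (z i)) = (if \<forall>i<d. z i \<in> B i then 1 else 0 :: real)" for z
    by (induction d) (auto simp: less_Suc_eq)
  have "emeasure (distr M (Pi\<^sub>M UNIV (\<lambda>_. borel)) (\<lambda>x i. Z i x))
          (prod_emb UNIV (\<lambda>_. borel) J (Pi\<^sub>E J A))
      = ennreal (\<integral>x. (\<Prod>i<d. indicator (B i) (Z i x)) \<partial>M)"
    if Z [measurable]: "\<And>i. Z i \<in> borel_measurable M" for Z
  proof -
    have "prod_emb UNIV (\<lambda>_. borel) J (Pi\<^sub>E J A) \<in> sets (Pi\<^sub>M UNIV (\<lambda>_. borel :: real measure))"
      using J A by (intro sets_PiM_I) auto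
    moreover have "(\<lambda>x i. Z i x) -` prod_emb UNIV (\<lambda>_. borel) J (Pi\<^sub>E J A) \<inter> space M
        = {x \<in> space M. \<forall>i<d. Z i x \<in> B i}"
      using d by (auto simp: prod_emb_def B_def PiE_iff subset_iff)
    ultimately have "emeasure (distr M (Pi\<^sub>M UNIV (\<lambda>_. borel)) (\<lambda>x i. Z i x)) (prod_emb UNIV (\<lambda>_. borel) J (Pi\<^sub>E J A))
      = emeasure M {x \<in> space M. \<forall>i<d. Z i x \<in> B i}"
      by (simp add: emeasure_distr[OF meas[OF Z]])
    also have "\<dots> = ennreal (\<integral>x. indicator {x \<in> space M. \<forall>i<d. Z i x \<in> B i} x \<partial>M)"
      by (simp add: emeasure_eq_measure Int_absorb2)
    also have "(\<integral>x. indicator {x \<in> space M. \<forall>i<d. Z i x \<in> B i} x \<partial>M)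
        = (\<integral>x. (\<Prod>i<d. indicator (B i) (Z i x)) \<partial>M :: real)"
      by (intro Bochner_Integration.integral_cong) (simp_all only: prod_ind, simp add: indicator_def)
    finally show ?thesis .
  qed
  note emb = this
  show "emeasure (distr M (Pi\<^sub>M UNIV (\<lambda>_. borel)) (\<lambda>x i. X i x)) (prod_emb UNIV (\<lambda>_. borel) J (Pi\<^sub>E J A)) =
    emeasure (distr M (Pi\<^sub>M UNIV (\<lambda>_. borel)) (\<lambda>x i. Y i x)) (prod_emb UNIV (\<lambda>_. borel) J (Pi\<^sub>E J A))"
    unfolding emb[OF X] emb[OF Y] by (intro arg_cong[where f=ennreal] joint_law_eqI X Y eq) measurable
qed simp_all

text \<open>With \<open>z = V x / U x\<close>, the integrand at \<open>a = - t\<close> is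
  \<open>\<bar>U x\<bar> * \<bar>z - t\<bar>\<close> where \<open>U x \<noteq> 0\<close>. Its right
  derivative in \<open>t\<close> is \<open>\<bar>U x\<bar>\<close> times -1 or 1 according to
  whether \<open>z > t\<close> or \<open>z \<le> t\<close>, so differentiating the integral recovers
  the distribution function. Points with \<open>U x = 0\<close> carry no weight.\<close>

lemma law_ratio_eqI:
  fixes U V V' :: "'a \<Rightarrow> real"
  assumes U: "integrable M U" and V: "integrable M V" and V': "integrable M V'"
    and eq: "\<And>a. (\<integral>x. \<bar>a * U x + V x\<bar> \<partial>M) = (\<integral>x. \<bar>a * U x + V' x\<bar> \<partial>M)"
  shows "distr (density M (\<lambda>x. \<bar>U x\<bar>)) borel (\<lambda>x. V x / U x)
       = distr (density M (\<lambda>x. \<bar>U x\<bar>)) borel (\<lambda>x. V' x / U x)"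
proof (rule cdf_unique')
  have [measurable]: "U \<in> borel_measurable M" using U by auto
  interpret finite_measure "density M (\<lambda>x. \<bar>U x\<bar>)"
    using U by (intro finite_measure_density) auto
  have fin: "finite_borel_measure (distr (density M (\<lambda>x. \<bar>U x\<bar>)) borel Z)"
    if [measurable]: "Z \<in> borel_measurable M" for Z
    unfolding finite_borel_measure_def finite_borel_measure_axioms_def
    by (auto intro!: finite_measure_distr)
  show "finite_borel_measure (distr (density M (\<lambda>x. \<bar>U x\<bar>)) borel (\<lambda>x. V x / U x))"
    "finite_borel_measure (distr (density M (\<lambda>x. \<bar>U x\<bar>)) borel (\<lambda>x. V' x / U x))"
    using V V' by (intro fin; measurable)+
  \<comment> \<open>The negated difference quotient in \<open>t\<close> with step
    \<open>1 / (n + 1)\<close> to the right. Stepping to the right counts the atom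
    \<open>z = t\<close> within \<open>{..t}\<close>, as the distribution function does.\<close>
  define D where "D V t n x = real (Suc n) * (\<bar>- t * U x + V x\<bar> - \<bar>(- t - 1 / real (Suc n)) * U x + V x\<bar>)"
    for V :: "'a \<Rightarrow> real" and t n x
  have lim: "(\<lambda>n. \<integral>x. D Z t n x \<partial>M) \<longlonglongrightarrow>
      (\<integral>x. \<bar>U x\<bar> \<partial>M) - 2 * (\<integral>x. \<bar>U x\<bar> * indicator {..t} (Z x / U x) \<partial>M)"
    if Z: "integrable M Z" for Z t
  proof -
    have [measurable]: "Z \<in> borel_measurable M" using Z by auto
    have "(\<lambda>n. \<integral>x. D Z t n x \<partial>M) \<longlonglongrightarrow>
      (\<integral>x. \<bar>U x\<bar> - 2 * (\<bar>U x\<bar> * indicator {..t} (Z x / U x)) \<partial>M)"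
    proof (rule integral_dominated_convergence[where w="\<lambda>x. \<bar>U x\<bar>"])
      show "AE x in M. (\<lambda>n. D Z t n x) \<longlonglongrightarrow> \<bar>U x\<bar> - 2 * (\<bar>U x\<bar> * indicator {..t} (Z x / U x))"
      proof (rule AE_I2)
        fix x
        show "(\<lambda>n. D Z t n x) \<longlonglongrightarrow> \<bar>U x\<bar> - 2 * (\<bar>U x\<bar> * indicator {..t} (Z x / U x))"
        proof (cases "U x = 0")
          case False
          define z where "z = Z x / U x"
          have "Z x = z * U x" using False by (simp add: z_def)
          then have "- t * U x + Z x = U x * (z - t)"
            "(- t - e) * U x + Z x = U x * (z - t - e)" for e by (simp_all add: algebra_simps)
          then have D: "D Z t n x = \<bar>U x\<bar> * (real (Suc n) * (\<bar>z - t\<bar> - \<bar>z - t - 1 / real (Suc n)\<bar>))" for n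
            unfolding D_def by (simp only: abs_mult) (simp add: algebra_simps)
          have "(\<lambda>n. 1 / real (Suc n)) \<longlonglongrightarrow> 0" by (rule LIMSEQ_Suc[OF lim_1_over_n])
          show ?thesis
          proof (cases "z \<le> t")
            case True
            have "D Z t n x = - \<bar>U x\<bar>" for n
            proof -
              have "0 < 1 / real (Suc n)" by simp
              then have "\<bar>z - t\<bar> - \<bar>z - t - 1 / real (Suc n)\<bar> = - (1 / real (Suc n))"
                using True by linarith
              then show ?thesis by (simp add: D)
            qed
            then show ?thesis using True by (simp add: z_def[symmetric])
          next
            case False
            have "\<forall>\<^sub>F n in sequentially. 1 / real (Suc n) < z - t"
              using order_tendstoD(2)[OF \<open>(\<lambda>n. 1 / real (Suc n)) \<longlonglongrightarrow> 0\<close>, of "z - t"] False by simp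
            then have "\<forall>\<^sub>F n in sequentially. D Z t n x = \<bar>U x\<bar>"
            proof eventually_elim
              case (elim n)
              then have "\<bar>z - t\<bar> - \<bar>z - t - 1 / real (Suc n)\<bar> = 1 / real (Suc n)"
                using False by simp
              then show ?case by (simp add: D)
            qed
            then show ?thesis using False by (simp add: z_def[symmetric] tendsto_eventually)
          qed
        qed (simp add: D_def)
      qed
      show "AE x in M. norm (D Z t n x) \<le> \<bar>U x\<bar>" for n
      proof (rule AE_I2)
        fix x
        have "\<bar>\<bar>- t * U x + Z x\<bar> - \<bar>(- t - 1 / real (Suc n)) * U x + Z x\<bar>\<bar> \<le> \<bar>U x / real (Suc n)\<bar>"
          by (rule order_trans[OF abs_triangle_ineq3]) (simp add: algebra_simps)
        then show "norm (D Z t n x) \<le> \<bar>U x\<bar>"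
          unfolding D_def real_norm_def abs_mult by (simp add: field_simps abs_mult del: of_nat_Suc)
      qed
    qed (use U in \<open>auto simp: D_def\<close>)
    also have "(\<integral>x. \<bar>U x\<bar> - 2 * (\<bar>U x\<bar> * indicator {..t} (Z x / U x)) \<partial>M) =
      (\<integral>x. \<bar>U x\<bar> \<partial>M) - 2 * (\<integral>x. \<bar>U x\<bar> * indicator {..t} (Z x / U x) \<partial>M)"
    proof -
      have "integrable M (\<lambda>x. \<bar>U x\<bar> * indicator {..t} (Z x / U x))"
        by (rule Bochner_Integration.integrable_bound[OF U]) (auto simp: indicator_def)
      then show ?thesis using U by simp
    qed
    finally show ?thesis .
  qed
  show "cdf (distr (density M (\<lambda>x. \<bar>U x\<bar>)) borel (\<lambda>x. V x / U x)) =
        cdf (distr (density M (\<lambda>x. \<bar>U x\<bar>)) borel (\<lambda>x. V' x / U x))"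
  proof
    fix t
    \<comment> \<open>Both integrals are of the form in the hypothesis, with \<open>a = - t\<close>
      and \<open>a = - t - 1 / (n + 1)\<close>.\<close>
    have "(\<integral>x. D Z t n x \<partial>M) = real (Suc n) * ((\<integral>x. \<bar>- t * U x + Z x\<bar> \<partial>M)
         - (\<integral>x. \<bar>(- t - 1 / real (Suc n)) * U x + Z x\<bar> \<partial>M))"
      if "integrable M Z" for n Z
      unfolding D_def by (subst integral_mult_right_zero, subst Bochner_Integration.integral_diff)
        (use that U in \<open>auto intro!: integrable_abs Bochner_Integration.integrable_add integrable_mult_right simp del: of_nat_Suc\<close>)
    then have "(\<integral>x. D V t n x \<partial>M) = (\<integral>x. D V' t n x \<partial>M)" for n
      using V V' by (simp only: eq)
    then have "(\<integral>x. \<bar>U x\<bar> \<partial>M) - 2 * (\<integral>x. \<bar>U x\<bar> * indicator {..t} (V x / U x) \<partial>M)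
        = (\<integral>x. \<bar>U x\<bar> \<partial>M) - 2 * (\<integral>x. \<bar>U x\<bar> * indicator {..t} (V' x / U x) \<partial>M)"
      using LIMSEQ_unique[OF lim[OF V, of t]] lim[OF V', of t] by simp
    moreover have "cdf (distr (density M (\<lambda>x. \<bar>U x\<bar>)) borel (\<lambda>x. Z x / U x)) t
        = (\<integral>x. \<bar>U x\<bar> * indicator {..t} (Z x / U x) \<partial>M)" if "integrable M Z" for Z
    proof -
      have [measurable]: "Z \<in> borel_measurable M" using that by auto
      show ?thesis unfolding cdf_def by (rule measure_distr_density) (use U in auto)
    qed
    ultimately show "cdf (distr (density M (\<lambda>x. \<bar>U x\<bar>)) borel (\<lambda>x. V x / U x)) t =
        cdf (distr (density M (\<lambda>x. \<bar>U x\<bar>)) borel (\<lambda>x. V' x / U x)) t"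
      using V V' by simp
  qed
qed

subsection \<open>Swap-invariant sequences\<close>

text \<open>The ratios only see the terms after index \<open>k\<close>, so the missing initial terms
  have to be restored, one per induction step. Each changes the averages by a vanishing summand and
  a factor tending to 1.\<close>

lemma convergent_mean_shift:
  fixes y :: "nat \<Rightarrow> real"
  assumes "convergent (\<lambda>n. (\<Sum>i<n. y (k + i)) / real n)"
  shows "convergent (\<lambda>n. (\<Sum>i<n. y i) / real n)"
  using assms
proof (induction k arbitrary: y)
  case (Suc k)
  then have "convergent (\<lambda>n. (\<Sum>i<n. y (Suc i)) / real n)"
    using Suc.IH[of "\<lambda>i. y (Suc i)"] by simp
  then obtain l where l: "(\<lambda>n. (\<Sum>i<n. y (Suc i)) / real n) \<longlonglongrightarrow> l"
    by (auto simp: convergent_def)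
  have "(\<lambda>n. y 0 / real (Suc n) + real n / real (Suc n) * ((\<Sum>i<n. y (Suc i)) / real n)) \<longlonglongrightarrow> 0 + 1 * l"
    by (intro tendsto_add tendsto_mult l LIMSEQ_n_over_Suc_n LIMSEQ_Suc[OF lim_const_over_n])
  also have "(\<lambda>n. y 0 / real (Suc n) + real n / real (Suc n) * ((\<Sum>i<n. y (Suc i)) / real n))
      = (\<lambda>n. (\<Sum>i<Suc n. y i) / real (Suc n))"
  proof
    fix n
    show "y 0 / real (Suc n) + real n / real (Suc n) * ((\<Sum>i<n. y (Suc i)) / real n) = (\<Sum>i<Suc n. y i) / real (Suc n)"
      by (cases "n = 0") (simp_all add: sum.lessThan_Suc_shift add_divide_distrib del: sum.lessThan_Suc of_nat_Suc)
  qed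
  finally have "(\<lambda>n. (\<Sum>i<n. y i) / real n) \<longlonglongrightarrow> 0 + 1 * l" by (rule LIMSEQ_imp_Suc)
  then show ?case by (auto simp: convergent_def)
qed simp

text \<open>A permutation of a block of \<open>d + 2\<close> consecutive terms that fixes the first
  and cycles the others realises the shift. The block has one term more than the combination uses,
  and the coefficient 0 there hides the term that wraps around.\<close>

lemma swap_invariant_sequence_shift:
  assumes "swap_invariant_sequence M \<xi>"
  shows "(\<integral>x. \<bar>a * \<xi> k x + (\<Sum>i<d. t i * \<xi> (k + 1 + i) x)\<bar> \<partial>M)
       = (\<integral>x. \<bar>a * \<xi> k x + (\<Sum>i<d. t i * \<xi> (k + 2 + i) x)\<bar> \<partial>M)"
proof -
  define u where "u i = (if i = 0 then a else if i \<le> d then t (i - 1) else 0)" for i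
  define \<tau> :: "nat \<Rightarrow> nat"
    where "\<tau> i = (if i = 0 \<or> d + 1 < i then i else if i = d + 1 then 1 else i + 1)" for i
  define \<tau>' :: "nat \<Rightarrow> nat"
    \<comment> \<open>The inverse cycle, used only as a witness that \<open>\<tau>\<close> is a
      bijection.\<close>
    where "\<tau>' i = (if i = 0 \<or> d + 1 < i then i else if i = 1 then d + 1 else i - 1)" for i
  have "bij_betw \<tau> {..<d + 2} {..<d + 2}"
    by (rule bij_betw_byWitness[where f'=\<tau>']) (auto simp: \<tau>_def \<tau>'_def)
  then have perm: "\<tau> permutes {..<d + 2}"
    by (rule bij_imp_permutes) (auto simp: \<tau>_def)
  have "strict_mono_on {..<d + 2} (\<lambda>i. k + i)" by (auto simp: strict_mono_on_def)
  with assms have "swap_invariant_vector M (d + 2) (\<lambda>i. \<xi> (k + i))"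
    by (auto simp: swap_invariant_sequence_def)
  then have "zonoid_equivalent (d + 2) M (\<lambda>i. \<xi> (k + id i)) M (\<lambda>i. \<xi> (k + \<tau> i))"
    unfolding swap_invariant_vector_def using perm permutes_id by blast
  then have eq: "(\<integral>x. \<bar>\<Sum>i<d + 2. u i * \<xi> (k + i) x\<bar> \<partial>M) = (\<integral>x. \<bar>\<Sum>i<d + 2. u i * \<xi> (k + \<tau> i) x\<bar> \<partial>M)"
    by (simp add: zonoid_equivalent_def)
  have sum_u: "(\<Sum>i<d + 2. u i * f i) = a * f 0 + (\<Sum>i<d. t i * f (i + 1))" for f :: "nat \<Rightarrow> real"
  proof -
    have "(\<Sum>i<d + 2. u i * f i) = u 0 * f 0 + (\<Sum>i<Suc d. u (Suc i) * f (Suc i))"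
      by (simp add: sum.lessThan_Suc_shift del: sum.lessThan_Suc)
    also have "\<dots> = a * f 0 + (\<Sum>i<d. u (Suc i) * f (Suc i))" by (simp add: u_def)
    also have "(\<Sum>i<d. u (Suc i) * f (Suc i)) = (\<Sum>i<d. t i * f (i + 1))"
      by (intro sum.cong) (auto simp: u_def)
    finally show ?thesis .
  qed
  have "\<tau> 0 = 0" "i < d \<Longrightarrow> \<tau> (i + 1) = i + 2" for i by (auto simp: \<tau>_def)
  then show ?thesis
    using eq unfolding sum_u[of "\<lambda>i. \<xi> (k + i) x" for x] sum_u[of "\<lambda>i. \<xi> (k + \<tau> i) x" for x]
    by (simp add: add_ac)
qed

lemma swap_invariant_sequence_AE_convergent:
  assumes swap: "swap_invariant_sequence M \<xi>"
  shows "AE x in M. \<xi> k x \<noteq> 0 \<longrightarrow> convergent (\<lambda>n. (\<Sum>i<n. \<xi> i x) / real n)"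
proof -
  have int: "integrable M (\<xi> i)" for i using swap by (simp add: swap_invariant_sequence_def)
  then have [measurable]: "\<xi> i \<in> borel_measurable M" for i by auto
  define Q where "Q = density M (\<lambda>x. \<bar>\<xi> k x\<bar>)"
  define Z where "Z i x = \<xi> (k + 1 + i) x / \<xi> k x" for i x
  have Z [measurable]: "Z i \<in> borel_measurable M" for i unfolding Z_def by measurable
  have ZQ: "Z i \<in> borel_measurable Q" for i using Z by (simp add: Q_def)
  interpret Q: finite_measure Q unfolding Q_def using int by (intro finite_measure_density) auto
  \<comment> \<open>A linear combination of the ratios is the ratio of a linear combination to
    \<open>\<xi> k\<close>, so its cosine integral depends only on the law that
    \<open>law_ratio_eqI\<close> controls.\<close>
  have eq: "(\<integral>x. cos (c + (\<Sum>i<d. t i * Z i x)) \<partial>Q) = (\<integral>x. cos (c + (\<Sum>i<d. t i * Z (Suc i) x)) \<partial>Q)"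
    for c d t
  proof -
    let ?V = "\<lambda>j x. \<Sum>i<d. t i * \<xi> (k + j + i) x"
    have distr: "distr Q borel (\<lambda>x. ?V 1 x / \<xi> k x) = distr Q borel (\<lambda>x. ?V 2 x / \<xi> k x)"
      unfolding Q_def using swap_invariant_sequence_shift[OF swap, where k=k and d=d and t=t] int
      by (intro law_ratio_eqI) auto
    have [measurable]: "(\<lambda>x. ?V j x / \<xi> k x) \<in> borel_measurable Q" for j by (simp add: Q_def)
    have "(\<integral>x. cos (c + ?V j x / \<xi> k x) \<partial>Q)
        = (\<integral>z. cos (c + z) \<partial>distr Q borel (\<lambda>x. ?V j x / \<xi> k x))" for j
      by (rule integral_distr[symmetric]) measurable
    with distr have "(\<integral>x. cos (c + ?V 1 x / \<xi> k x) \<partial>Q) = (\<integral>x. cos (c + ?V 2 x / \<xi> k x) \<partial>Q)"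
      by (simp only:)
    then show ?thesis by (simp add: Z_def sum_divide_distrib)
  qed
  \<comment> \<open>The density cancels the denominator:
    \<open>\<bar>\<xi> k\<bar> * \<bar>Z 0\<bar>\<close> is bounded by
    \<open>\<bar>\<xi> (k + 1)\<bar>\<close>.\<close>
  have "integrable M (\<lambda>x. \<bar>\<xi> k x\<bar> *\<^sub>R Z 0 x)"
    by (rule Bochner_Integration.integrable_bound[OF int[of "k + 1"]]) (auto simp: Z_def abs_mult)
  then have "integrable Q (Z 0)"
    unfolding Q_def by (subst integrable_density) auto
  moreover have "distr Q (Pi\<^sub>M UNIV (\<lambda>_. borel)) (\<lambda>x i. Z i x) = distr Q (Pi\<^sub>M UNIV (\<lambda>_. borel)) (\<lambda>x i. Z (Suc i) x)"
    by (rule Q.distr_PiM_eqI) (rule ZQ eq)+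
  ultimately have "AE x in Q. convergent (\<lambda>n. (\<Sum>i<n. Z i x) / real n)"
    by (intro Q.stationary_imp_convergent_mean ZQ)
  \<comment> \<open>The measure \<open>Q\<close> does not see the zeros of \<open>\<xi> k\<close>,
    hence the condition in the conclusion.\<close>
  then have "AE x in M. 0 < \<bar>\<xi> k x\<bar> \<longrightarrow> convergent (\<lambda>n. (\<Sum>i<n. Z i x) / real n)"
    unfolding Q_def by (subst (asm) AE_density) auto
  then show ?thesis
  proof eventually_elim
    case (elim x)
    show ?case
    proof
      assume nz: "\<xi> k x \<noteq> 0"
      with elim have "convergent (\<lambda>n. \<xi> k x * ((\<Sum>i<n. Z i x) / real n))"
        by (intro convergent_mult convergent_const) auto
      moreover have "\<xi> k x * ((\<Sum>i<n. Z i x) / real n) = (\<Sum>i<n. \<xi> (k + 1 + i) x) / real n" for n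
        using nz by (simp add: Z_def sum_divide_distrib[symmetric])
      ultimately show "convergent (\<lambda>n. (\<Sum>i<n. \<xi> i x) / real n)"
        using convergent_mean_shift[where k="k + 1" and y="\<lambda>i. \<xi> i x"] by (simp only:)
    qed
  qed
qed

section \<open>Integrability of the limit and conclusion\<close>

lemma integrable_LIMSEQ_Fatou:
  fixes f :: "nat \<Rightarrow> 'a \<Rightarrow> real"
  assumes f: "\<And>n. integrable M (f n)" and bound: "\<And>n. (\<integral>x. \<bar>f n x\<bar> \<partial>M) \<le> C"
    and g [measurable]: "g \<in> borel_measurable M"
    and lim: "AE x in M. (\<lambda>n. f n x) \<longlonglongrightarrow> g x"
  shows "integrable M g"
proof (rule integrableI_bounded)
  have [measurable]: "f n \<in> borel_measurable M" for n using f by auto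
  have "(\<integral>\<^sup>+x. ennreal (norm (g x)) \<partial>M) = (\<integral>\<^sup>+x. liminf (\<lambda>n. ennreal \<bar>f n x\<bar>) \<partial>M)"
  proof (rule nn_integral_cong_AE)
    show "AE x in M. ennreal (norm (g x)) = liminf (\<lambda>n. ennreal \<bar>f n x\<bar>)"
      using lim
    proof eventually_elim
      case (elim x)
      then have "(\<lambda>n. ennreal \<bar>f n x\<bar>) \<longlonglongrightarrow> ennreal \<bar>g x\<bar>"
        by (intro tendsto_ennrealI tendsto_rabs)
      then show ?case by (simp only: real_norm_def lim_imp_Liminf[OF trivial_limit_sequentially])
    qed
  qed
  also have "\<dots> \<le> liminf (\<lambda>n. \<integral>\<^sup>+x. ennreal \<bar>f n x\<bar> \<partial>M)"
    by (rule nn_integral_liminf) measurable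
  also have "\<dots> = liminf (\<lambda>n. ennreal (\<integral>x. \<bar>f n x\<bar> \<partial>M))"
    using f by (simp add: nn_integral_eq_integral)
  also have "\<dots> \<le> ennreal C"
    using bound by (intro Liminf_le always_eventually allI ennreal_leI) auto
  also have "\<dots> < \<infinity>" by simp
  finally show "(\<integral>\<^sup>+x. ennreal (norm (g x)) \<partial>M) < \<infinity>" .
qed fact

text \<open>Coefficient 0 on the fixed term and a single shifted term reduce the shift identity to
  neighbouring first absolute moments.\<close>

lemma swap_invariant_sequence_abs_integral:
  assumes "swap_invariant_sequence M \<xi>"
  shows "(\<integral>x. \<bar>\<xi> (Suc i) x\<bar> \<partial>M) = (\<integral>x. \<bar>\<xi> 1 x\<bar> \<partial>M)"
proof (induction i)
  case (Suc i)
  then show ?case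
    using swap_invariant_sequence_shift[OF assms, where a=0 and k=i and d=1 and t="\<lambda>_. 1"] by simp
qed simp

theorem theorem17:
  fixes M :: "'a measure" and \<xi> :: "nat \<Rightarrow> 'a \<Rightarrow> real"
  assumes "prob_space M"
    and "swap_invariant_sequence M \<xi>"
    and "\<And>n. \<not> (AE \<omega> in M. \<xi> n \<omega> = 0)"
  shows "\<exists>X :: 'a \<Rightarrow> real. integrable M X \<and>
           (AE \<omega> in M. (\<lambda>n. (\<Sum>i<n. \<xi> i \<omega>) / real n) \<longlonglongrightarrow> X \<omega>)"
proof (intro exI conjI)
  define A where "A n \<omega> = (\<Sum>i<n. \<xi> i \<omega>) / real n" for n \<omega>
  have int: "integrable M (\<xi> i)" for i using assms(2) by (simp add: swap_invariant_sequence_def)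
  then have [measurable]: "\<xi> i \<in> borel_measurable M" for i by auto
  have A: "integrable M (A n)" for n unfolding A_def using int by auto
  have [measurable]: "A n \<in> borel_measurable M" for n using A by auto
  have "AE \<omega> in M. \<forall>k. \<xi> k \<omega> \<noteq> 0 \<longrightarrow> convergent (\<lambda>n. A n \<omega>)"
    unfolding A_def AE_all_countable by (intro allI swap_invariant_sequence_AE_convergent assms)
  then show lim: "AE \<omega> in M. (\<lambda>n. (\<Sum>i<n. \<xi> i \<omega>) / real n) \<longlonglongrightarrow> lim (\<lambda>n. A n \<omega>)"
  proof eventually_elim
    case (elim \<omega>)
    \<comment> \<open>Some nonzero term gives convergence by the previous lemmas; if all terms
      vanish, the averages are constantly 0.\<close>
    have "convergent (\<lambda>n. A n \<omega>)"
    proof (cases "\<forall>k. \<xi> k \<omega> = 0")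
      case True
      then show ?thesis by (simp add: A_def convergent_const)
    qed (use elim in auto)
    then show ?case by (simp add: convergent_LIMSEQ_iff A_def)
  qed
  \<comment> \<open>The chain of equal moments above starts at index 1, so the moment of
    \<open>\<xi> 0\<close> is added to obtain a bound for every index.\<close>
  define C where "C = (\<integral>\<omega>. \<bar>\<xi> 0 \<omega>\<bar> \<partial>M) + (\<integral>\<omega>. \<bar>\<xi> 1 \<omega>\<bar> \<partial>M)"
  have C: "(\<integral>\<omega>. \<bar>\<xi> i \<omega>\<bar> \<partial>M) \<le> C" for i
  proof (cases i)
    case (Suc j)
    show ?thesis
      unfolding C_def Suc swap_invariant_sequence_abs_integral[OF assms(2)] by simp
  qed (simp add: C_def)
  have "0 \<le> C" by (simp add: C_def)
  show "integrable M (\<lambda>\<omega>. lim (\<lambda>n. A n \<omega>))"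
  proof (rule integrable_LIMSEQ_Fatou[OF A])
    show "(\<integral>\<omega>. \<bar>A n \<omega>\<bar> \<partial>M) \<le> C" for n
    proof (cases "n = 0")
      case False
      have "(\<integral>\<omega>. \<bar>A n \<omega>\<bar> \<partial>M) \<le> (\<integral>\<omega>. (\<Sum>i<n. \<bar>\<xi> i \<omega>\<bar>) / real n \<partial>M)"
        using int A by (intro integral_mono) (auto simp: A_def intro!: divide_right_mono)
      also have "\<dots> = (\<Sum>i<n. \<integral>\<omega>. \<bar>\<xi> i \<omega>\<bar> \<partial>M) / real n" using int by simp
      also have "\<dots> \<le> (\<Sum>i<n. C) / real n" by (intro divide_right_mono sum_mono C) simp
      also have "\<dots> = C" using False by simp
      finally show ?thesis .
    qed (use \<open>0 \<le> C\<close> in \<open>simp add: A_def\<close>)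
    show "AE \<omega> in M. (\<lambda>n. A n \<omega>) \<longlonglongrightarrow> lim (\<lambda>n. A n \<omega>)" using lim by (simp add: A_def)
  qed measurable
qed

end
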